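(* Let $n\ge1$. For any $a,b>0$, the space of invariant spinors on $(S^{2n+1}=\mathrm{SU}(n+1)/\mathrm{SU}(n),g_{a,b})$ is $$\Sigma_{\mathrm{inv}}=\mathrm{span}_{\mathbb C}\{\psi_+:=1,\ \ \psi_-:=y_1\wedge y_2\wedge\dots\wedge y_n\}.$$
   Context: $E_{i,j}$ is the $(n+1)\times(n+1)$ matrix with $-1$ in position $(i,j)$, $+1$ in $(j,i)$; $F_{i,j}$ ($i\ne j$) has $1$ in $(i,j)$ and $(j,i)$; $F_{i,i}$ has $1$ in $(i,i)$; other entries zero. $B_0(X_1,X_2)=-\mathrm{Re}\,\mathrm{tr}(X_1X_2)$. $\mathrm{SU}(n)\subset\mathrm{SU}(n+1)$ is the lower right block, $\mathfrak h=\mathfrak{su}(n)$, and $\mathfrak m=\mathfrak h^{\perp_{B_0}}=\mathfrak m_1\oplus\mathfrak m_2$, $g_{a,b}=aB_0|_{\mathfrak m_1}+bB_0|_{\mathfrak m_2}$, with $g_{a,b}$-orthonormal basis $e_1=\frac1{\sqrt{an(n+1)}}(-niF_{1,1}+\sum_{l=2}^{n+1}iF_{l,l})$ of $\mathfrak m_1$ and $e_{2p}=\frac1{\sqrt{2b}}E_{1,p+1}$, $e_{2p+1}=\frac{i}{\sqrt{2b}}F_{1,p+1}$ ($p=1,\dots,n$) of $\mathfrak m_2$. Spin module: $x_j=\frac1{\sqrt2}(e_{2j}-ie_{2j+1})$, $y_j=\frac1{\sqrt2}(e_{2j}+ie_{2j+1})$ ($1\le j\le n$), $\Sigma=\Lambda^\bullet\mathrm{span}_{\mathbb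 C}\{y_1,\dots,y_n\}$, $e_{2j}\cdot\eta=i(x_j\lrcorner\eta+y_j\wedge\eta)$, $e_{2j+1}\cdot\eta=y_j\wedge\eta-x_j\lrcorner\eta$, $e_1\cdot\eta=i\eta$ (even degree), $-i\eta$ (odd degree), where $x_j\lrcorner$ is the antiderivation with $x_j\lrcorner y_k=\delta_{jk}$. The spin lift of the skew endomorphism $e_i\wedge e_j$ ($e_i\mapsto e_j$, $e_j\mapsto-e_i$) is $\frac12e_i\cdot e_j$. Invariant spinors are the constant $H$-equivariant maps $G\to\Sigma$; equivalently ($H$ connected) $\Sigma_{\mathrm{inv}}=\{\psi\in\Sigma:\widetilde{\mathrm{ad}(h)|_{\mathfrak m}}\cdot\psi=0\ \forall h\in\mathfrak h\}$, tilde denoting the spin lift. *)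

theory Defs
  imports
    Complex_Main
    "HOL.Hull"
    "HOL-Library.Function_Algebras"
    "Jordan_Normal_Form.Schur_Decomposition"
begin

section \<open>The homogeneous space $\mathrm{SU}(n+1)/\mathrm{SU}(n)$ at the Lie algebra level\<close>

definition mat_trace :: "complex mat \<Rightarrow> complex" where
  "mat_trace X = (\<Sum>k<dim_row X. X $$ (k, k))"

definition su :: "nat \<Rightarrow> complex mat set" where
  "su k = {X \<in> carrier_mat k k. mat_adjoint X = - X \<and> mat_trace X = 0}"

definition isotropy_algebra :: "nat \<Rightarrow> complex mat set" where
  "isotropy_algebra n =
     (\<lambda>A. four_block_mat (0\<^sub>m 1 1) (0\<^sub>m 1 n) (0\<^sub>m n 1) A) ` su n"

definition B0 :: "complex mat \<Rightarrow> complex mat \<Rightarrow> real" where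
  "B0 X Y = - Re (mat_trace (X * Y))"

definition reductive_complement :: "nat \<Rightarrow> complex mat set" where
  "reductive_complement n = {X \<in> su (n + 1). \<forall>Y \<in> isotropy_algebra n. B0 X Y = 0}"

(* The positions of E and F are counted from 1, whereas matrix entries are indexed from 0. *)
definition E_mat :: "nat \<Rightarrow> nat \<Rightarrow> nat \<Rightarrow> complex mat" where
  "E_mat n i j = mat (n + 1) (n + 1) (\<lambda>(k, l).
     if (Suc k, Suc l) = (i, j) then -1 else if (Suc k, Suc l) = (j, i) then 1 else 0)"

definition F_mat :: "nat \<Rightarrow> nat \<Rightarrow> nat \<Rightarrow> complex mat" where
  "F_mat n i j = mat (n + 1) (n + 1) (\<lambda>(k, l).
     if (Suc k, Suc l) = (i, j) \<or> (Suc k, Suc l) = (j, i) then 1 else 0)"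

(* - n i F_{1,1} + i F_{2,2} + ... + i F_{n+1,n+1} *)
definition T_mat :: "nat \<Rightarrow> complex mat" where
  "T_mat n = foldl (\<lambda>X l. X + \<i> \<cdot>\<^sub>m F_mat n l l)
     ((- (of_nat n * \<i>)) \<cdot>\<^sub>m F_mat n 1 1) [2..<n + 2]"

definition real_subspace :: "nat \<Rightarrow> complex mat set \<Rightarrow> bool" where
  "real_subspace k V \<longleftrightarrow> V \<subseteq> carrier_mat k k \<and> 0\<^sub>m k k \<in> V \<and>
     (\<forall>X\<in>V. \<forall>Y\<in>V. X + Y \<in> V) \<and> (\<forall>r::real. \<forall>X\<in>V. complex_of_real r \<cdot>\<^sub>m X \<in> V)"

(* The spans of e_1 and of e_2, ..., e_{2n+1} (basis_vec below); as real subspaces they do not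
   depend on the scalings by a and b, so the unnormalised vectors are used. *)
definition m1 :: "nat \<Rightarrow> complex mat set" where
  "m1 n = real_subspace (n + 1) hull {T_mat n}"

definition m2 :: "nat \<Rightarrow> complex mat set" where
  "m2 n = real_subspace (n + 1) hull
     (\<Union>p\<in>{1..n}. {E_mat n 1 (p + 1), \<i> \<cdot>\<^sub>m F_mat n 1 (p + 1)})"

definition m1_part :: "nat \<Rightarrow> complex mat \<Rightarrow> complex mat" where
  "m1_part n X = (THE X1. X1 \<in> m1 n \<and> (\<exists>X2 \<in> m2 n. X = X1 + X2))"

definition m2_part :: "nat \<Rightarrow> complex mat \<Rightarrow> complex mat" where
  "m2_part n X = (THE X2. X2 \<in> m2 n \<and> (\<exists>X1 \<in> m1 n. X = X1 + X2))"

definition metric :: "nat \<Rightarrow> real \<Rightarrow> real \<Rightarrow> complex mat \<Rightarrow> complex mat \<Rightarrow> real" where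
  "metric n a b X Y =
     a * B0 (m1_part n X) (m1_part n Y) + b * B0 (m2_part n X) (m2_part n Y)"

(* The orthonormal basis e_1, ..., e_{2n+1} of the reductive complement. *)
definition basis_vec :: "nat \<Rightarrow> real \<Rightarrow> real \<Rightarrow> nat \<Rightarrow> complex mat" where
  "basis_vec n a b k =
     (if k = 1 then complex_of_real (1 / sqrt (a * real n * real (n + 1))) \<cdot>\<^sub>m T_mat n
      else if even k then complex_of_real (1 / sqrt (2 * b)) \<cdot>\<^sub>m E_mat n 1 (k div 2 + 1)
      else (\<i> * complex_of_real (1 / sqrt (2 * b))) \<cdot>\<^sub>m F_mat n 1 (k div 2 + 1))"

definition ad :: "complex mat \<Rightarrow> complex mat \<Rightarrow> complex mat" where
  "ad h X = h * X - X * h"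

lemma T_mat_eq:
  "T_mat n = mat (n + 1) (n + 1)
     (\<lambda>(k, l). if k \<noteq> l then 0 else if k = 0 then - (of_nat n * \<i>) else \<i>)"
proof -
  have "foldl (\<lambda>X l. X + \<i> \<cdot>\<^sub>m F_mat n l l) ((- (of_nat n * \<i>)) \<cdot>\<^sub>m F_mat n 1 1) [2..<m + 2]
      = mat (n + 1) (n + 1) (\<lambda>(k, l). if k \<noteq> l \<or> k > m then 0 else if k = 0 then - (of_nat n * \<i>) else \<i>)" for m
    by (induction m) (auto simp: F_mat_def intro!: eq_matI)
  from this[of n] show ?thesis unfolding T_mat_def by (auto intro!: eq_matI)
qed

lemma mat_adjoint_eq:
  assumes "X \<in> carrier_mat k k"
  shows "mat_adjoint X = mat k k (\<lambda>(i, j). cnj (X $$ (j, i)))"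
  using assms by (auto simp: mat_adjoint_def mat_of_rows_def conjugate_complex_def intro!: eq_matI)

lemma su_iff:
  "X \<in> su k \<longleftrightarrow> X \<in> carrier_mat k k \<and> (\<forall>i<k. \<forall>j<k. X $$ (i, j) = - cnj (X $$ (j, i))) \<and>
     (\<Sum>i<k. X $$ (i, i)) = 0"
proof (cases "X \<in> carrier_mat k k")
  case True
  have "mat_adjoint X = - X \<longleftrightarrow> (\<forall>i<k. \<forall>j<k. X $$ (i, j) = - cnj (X $$ (j, i)))"
    unfolding mat_adjoint_eq[OF True] mat_eq_iff using True
    by (auto simp: equation_minus_iff eq_commute minus_equation_iff)
  then show ?thesis using True by (auto simp: su_def mat_trace_def)
qed (auto simp: su_def)

lemma m1_eq: "m1 n = {complex_of_real r \<cdot>\<^sub>m T_mat n | r. True}"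
  unfolding m1_def
proof (rule hull_unique)
  show "{T_mat n} \<subseteq> {complex_of_real r \<cdot>\<^sub>m T_mat n |r. True}"
    by (auto intro!: exI[of _ 1] eq_matI)
  have T: "T_mat n \<in> carrier_mat (n+1) (n+1)" by (simp add: T_mat_eq)
  show "real_subspace (n + 1) {complex_of_real r \<cdot>\<^sub>m T_mat n |r. True}"
    unfolding real_subspace_def
  proof (intro conjI ballI allI subsetI)
    show "0\<^sub>m (n+1) (n+1) \<in> {complex_of_real r \<cdot>\<^sub>m T_mat n |r. True}"
      using T by (auto intro!: exI[of _ 0] eq_matI)
  next
    fix X Y assume "X \<in> {complex_of_real r \<cdot>\<^sub>m T_mat n |r. True}" "Y \<in> {complex_of_real r \<cdot>\<^sub>m T_mat n |r. True}"
    then obtain r s where "X = complex_of_real r \<cdot>\<^sub>m T_mat n" "Y = complex_of_real s \<cdot>\<^sub>m T_mat n" by auto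
    then show "X + Y \<in> {complex_of_real r \<cdot>\<^sub>m T_mat n |r. True}"
      using T by (auto intro!: exI[of _ "r + s"] eq_matI simp: algebra_simps)
  next
    fix c :: real and X assume "X \<in> {complex_of_real r \<cdot>\<^sub>m T_mat n |r. True}"
    then obtain r where "X = complex_of_real r \<cdot>\<^sub>m T_mat n" by auto
    then show "complex_of_real c \<cdot>\<^sub>m X \<in> {complex_of_real r \<cdot>\<^sub>m T_mat n |r. True}"
      using T by (auto intro!: exI[of _ "c * r"] eq_matI simp: algebra_simps)
  qed (use T in auto)
next
  fix V assume V: "{T_mat n} \<subseteq> V" "real_subspace (n + 1) V"
  then show "{complex_of_real r \<cdot>\<^sub>m T_mat n |r. True} \<subseteq> V"
    by (auto simp: real_subspace_def)
qed

lemma m2_eq: "m2 n = {X \<in> carrier_mat (n+1) (n+1). X $$ (0,0) = 0 \<and>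
     (\<forall>k\<in>{1..n}. X $$ (0,k) = - cnj (X $$ (k,0))) \<and>
     (\<forall>k\<in>{1..n}. \<forall>l\<in>{1..n}. X $$ (k,l) = 0)}" (is "_ = ?R")
  unfolding m2_def
proof (rule hull_unique)
  show "(\<Union>p\<in>{1..n}. {E_mat n 1 (p + 1), \<i> \<cdot>\<^sub>m F_mat n 1 (p + 1)}) \<subseteq> ?R"
    by (auto simp: E_mat_def F_mat_def)
  show "real_subspace (n + 1) ?R"
    unfolding real_subspace_def by auto
next
  fix V assume V: "(\<Union>p\<in>{1..n}. {E_mat n 1 (p + 1), \<i> \<cdot>\<^sub>m F_mat n 1 (p + 1)}) \<subseteq> V"
    "real_subspace (n + 1) V"
  define m2x where "m2x p = {X \<in> carrier_mat (n+1) (n+1). X $$ (0,0) = 0 \<and>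
     (\<forall>k\<in>{1..n}. X $$ (0,k) = - cnj (X $$ (k,0)) \<and> (k > p \<longrightarrow> X $$ (0,k) = 0)) \<and>
     (\<forall>k\<in>{1..n}. \<forall>l\<in>{1..n}. X $$ (k,l) = 0)}" for p
  have "X \<in> V" if "p \<le> n" "X \<in> m2x p" for p X
    using that
  proof (induction p arbitrary: X)
    case 0
    have "X = 0\<^sub>m (n+1) (n+1)"
    proof (rule eq_matI, goal_cases)
      case (1 i j)
      then show ?case using 0 unfolding m2x_def
        by (cases "i = 0"; cases "j = 0"; force)
    qed (use 0 in \<open>auto simp: m2x_def\<close>)
    then show ?case using V by (simp add: real_subspace_def)
  next
    case (Suc p)
    define c where "c = X $$ (Suc p, 0)"
    let ?E = "E_mat n 1 (Suc p + 1)" and ?F = "\<i> \<cdot>\<^sub>m F_mat n 1 (Suc p + 1)"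
    let ?A = "complex_of_real (Re c) \<cdot>\<^sub>m ?E" and ?B = "complex_of_real (Im c) \<cdot>\<^sub>m ?F"
    let ?X = "mat (n+1) (n+1) (\<lambda>(k,l). if k = Suc p \<or> l = Suc p then 0 else X $$ (k,l))"
    have cX: "X \<in> carrier_mat (n+1) (n+1)" using Suc by (simp add: m2x_def)
    have p: "Suc p \<in> {1..n}" using Suc.prems(1) by simp
    have "?X \<in> V"
      by (rule Suc.IH) (use Suc.prems in \<open>auto simp: m2x_def\<close>)
    moreover have "?E \<in> V" "?F \<in> V"
      using V(1) p by blast+
    ultimately have "?X + (?A + ?B) \<in> V" using V(2) unfolding real_subspace_def by blast
    moreover have "X = ?X + (?A + ?B)"
    proof (rule eq_matI, goal_cases)
      case (1 i j)
      then have ij: "i < n + 1" "j < n + 1" by (simp_all add: F_mat_def)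
      have c0: "X $$ (0, Suc p) = - cnj c" "X $$ (Suc p, 0) = c"
        using Suc.prems by (auto simp: m2x_def c_def)
      have z: "X $$ (i,j) = 0" if "i \<noteq> 0" "j \<noteq> 0"
        using Suc.prems ij that by (auto simp: m2x_def)
      show ?case using ij c0 z
        by (auto simp: E_mat_def F_mat_def complex_eq_iff)
    qed (use cX in \<open>auto simp: F_mat_def\<close>)
    ultimately show ?case by simp
  qed
  from this[of n] show "?R \<subseteq> V" by (auto simp: m2x_def)
qed

lemma B0_eq:
  assumes "X \<in> carrier_mat k k" "Y \<in> carrier_mat k k"
  shows "B0 X Y = - (\<Sum>i<k. \<Sum>j<k. Re (X $$ (i,j) * Y $$ (j,i)))"
  using assms by (simp add: B0_def mat_trace_def scalar_prod_def atLeast0LessThan)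

lemma isotropy_algebra_iff:
  "Y \<in> isotropy_algebra n \<longleftrightarrow> Y \<in> su (n+1) \<and> (\<forall>k\<le>n. Y $$ (0,k) = 0 \<and> Y $$ (k,0) = 0)"
proof
  assume "Y \<in> isotropy_algebra n"
  then obtain A where A: "A \<in> su n" and Y: "Y = four_block_mat (0\<^sub>m 1 1) (0\<^sub>m 1 n) (0\<^sub>m n 1) A"
    unfolding isotropy_algebra_def by blast
  have c: "A \<in> carrier_mat n n" and tr: "(\<Sum>i<n. A $$ (i,i)) = 0"
    using A unfolding su_iff by blast+
  have skew: "A $$ (i,j) = - cnj (A $$ (j,i))" if "i < n" "j < n" for i j
    using A that unfolding su_iff by blast
  have e: "Y $$ (0,k) = 0" "Y $$ (k,0) = 0" if "k \<le> n" for k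
    using that c by (auto simp: Y)
  have eS: "Y $$ (Suc i, Suc j) = A $$ (i,j)" if "i < n" "j < n" for i j
    using that c by (simp add: Y)
  have "Y \<in> su (n+1)"
    unfolding su_iff
  proof (intro conjI allI impI)
    show "Y \<in> carrier_mat (n+1) (n+1)" using c by (auto simp: Y)
  next
    fix i j assume ij: "i < n + 1" "j < n + 1"
    show "Y $$ (i,j) = - cnj (Y $$ (j,i))"
    proof (cases "i = 0 \<or> j = 0")
      case True
      then show ?thesis using ij e by auto
    next
      case False
      then obtain k l where "i = Suc k" "j = Suc l" "k < n" "l < n"
        using ij by (cases i; cases j) auto
      then show ?thesis using skew[of k l] by (simp add: eS)
    qed
  next
    show "(\<Sum>i<n+1. Y $$ (i,i)) = 0"
      using tr by (simp add: sum.lessThan_Suc_shift e eS del: sum.lessThan_Suc)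
  qed
  then show "Y \<in> su (n+1) \<and> (\<forall>k\<le>n. Y $$ (0,k) = 0 \<and> Y $$ (k,0) = 0)" using e by blast
next
  assume *: "Y \<in> su (n+1) \<and> (\<forall>k\<le>n. Y $$ (0,k) = 0 \<and> Y $$ (k,0) = 0)"
  then have c: "Y \<in> carrier_mat (n+1) (n+1)" and tr: "(\<Sum>i<n+1. Y $$ (i,i)) = 0"
    and z: "\<And>k. k \<le> n \<Longrightarrow> Y $$ (0,k) = 0" "\<And>k. k \<le> n \<Longrightarrow> Y $$ (k,0) = 0"
    unfolding su_iff by blast+
  have skew: "Y $$ (i,j) = - cnj (Y $$ (j,i))" if "i < n + 1" "j < n + 1" for i j
    using * that unfolding su_iff by blast
  let ?A = "mat n n (\<lambda>(i,j). Y $$ (Suc i, Suc j))"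
  have "?A \<in> su n"
    unfolding su_iff
  proof (intro conjI allI impI)
    show "?A $$ (i,j) = - cnj (?A $$ (j,i))" if "i < n" "j < n" for i j
      using skew[of "Suc i" "Suc j"] that by simp
    show "(\<Sum>i<n. ?A $$ (i,i)) = 0"
      using tr by (simp add: sum.lessThan_Suc_shift z del: sum.lessThan_Suc)
  qed simp
  moreover have "Y = four_block_mat (0\<^sub>m 1 1) (0\<^sub>m 1 n) (0\<^sub>m n 1) ?A"
    by (rule eq_matI) (use c z in auto)
  ultimately show "Y \<in> isotropy_algebra n" unfolding isotropy_algebra_def by blast
qed

lemma m1_part_add:
  assumes "X1 \<in> m1 n" "X2 \<in> m2 n" "n \<ge> 1"
  shows "m1_part n (X1 + X2) = X1" "m2_part n (X1 + X2) = X2"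
proof -
  have uniq: "X1 = Z1 \<and> X2 = Z2"
    if Z: "Z1 \<in> m1 n" "Z2 \<in> m2 n" and eq: "X1 + X2 = Z1 + Z2" for Z1 Z2
  proof -
    obtain r s where rs: "X1 = complex_of_real r \<cdot>\<^sub>m T_mat n" "Z1 = complex_of_real s \<cdot>\<^sub>m T_mat n"
      using assms Z by (auto simp: m1_eq)
    have c: "X2 \<in> carrier_mat (n+1) (n+1)" "Z2 \<in> carrier_mat (n+1) (n+1)"
      using assms Z by (auto simp: m2_eq)
    have "(X1 + X2) $$ (1,1) = (Z1 + Z2) $$ (1,1)" by (simp add: eq)
    then have "r = s" using c assms Z(2) rs by (auto simp: m2_eq T_mat_eq)
    moreover have "X2 = Z2"
    proof (rule eq_matI, goal_cases)
      case (1 i j)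
      have "(X1 + X2) $$ (i,j) = (Z1 + Z2) $$ (i,j)" by (simp add: eq)
      then show ?case using 1 c rs \<open>r = s\<close> by (auto simp: T_mat_eq)
    qed (use c in auto)
    ultimately show ?thesis using rs by simp
  qed
  show "m1_part n (X1 + X2) = X1" "m2_part n (X1 + X2) = X2"
    unfolding m1_part_def m2_part_def
    by (rule the_equality; use uniq assms in blast)+
qed

lemma zero_in_m: "0\<^sub>m (n+1) (n+1) \<in> m1 n" "0\<^sub>m (n+1) (n+1) \<in> m2 n"
  by (auto simp: m1_eq m2_eq T_mat_eq intro!: exI[of _ 0] eq_matI)

lemma B0_m2:
  assumes "X \<in> m2 n" "Y \<in> m2 n"
  shows "B0 X Y = 2 * (\<Sum>k\<in>{1..n}. Re (X $$ (k,0) * cnj (Y $$ (k,0))))"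
proof -
  have X: "X $$ (0,0) = 0" "\<And>k. k < n \<Longrightarrow> X $$ (0,Suc k) = - cnj (X $$ (Suc k,0))"
     "\<And>k l. k < n \<Longrightarrow> l < n \<Longrightarrow> X $$ (Suc k,Suc l) = 0" using assms by (auto simp: m2_eq)
  have Y: "Y $$ (0,0) = 0" "\<And>k. k < n \<Longrightarrow> Y $$ (0,Suc k) = - cnj (Y $$ (Suc k,0))"
     "\<And>k l. k < n \<Longrightarrow> l < n \<Longrightarrow> Y $$ (Suc k,Suc l) = 0" using assms by (auto simp: m2_eq)
  have "B0 X Y = - (\<Sum>i<n+1. \<Sum>j<n+1. Re (X $$ (i,j) * Y $$ (j,i)))"
    by (rule B0_eq) (use assms in \<open>auto simp: m2_eq\<close>)
  also have "\<dots> = 2 * (\<Sum>k<n. Re (X $$ (Suc k,0) * cnj (Y $$ (Suc k,0))))"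
  proof -
    define g where "g i = (\<Sum>j<n+1. Re (X $$ (i,j) * Y $$ (j,i)))" for i
    have "g 0 = - (\<Sum>k<n. Re (X $$ (Suc k,0) * cnj (Y $$ (Suc k,0))))"
      using X Y by (simp add: g_def sum.lessThan_Suc_shift del: sum.lessThan_Suc flip: sum_negf)
        (simp flip: sum.distrib)
    moreover have "(\<Sum>i<n. g (Suc i)) = - (\<Sum>k<n. Re (X $$ (Suc k,0) * cnj (Y $$ (Suc k,0))))"
      unfolding sum_negf[symmetric]
      by (rule sum.cong) (use X Y in \<open>simp_all add: g_def sum.lessThan_Suc_shift del: sum.lessThan_Suc\<close>)
    moreover have "(\<Sum>i<n+1. g i) = g 0 + (\<Sum>i<n. g (Suc i))"
      by (simp add: sum.lessThan_Suc_shift del: sum.lessThan_Suc)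
    ultimately show ?thesis unfolding g_def by linarith
  qed
  also have "(\<Sum>k<n. Re (X $$ (Suc k,0) * cnj (Y $$ (Suc k,0)))) = (\<Sum>k\<in>{1..n}. Re (X $$ (k,0) * cnj (Y $$ (k,0))))"
    by (rule sum.reindex_bij_witness[of _ "\<lambda>k. k - 1" Suc]) auto
  finally show ?thesis .
qed

lemma B0_T: "B0 (complex_of_real r \<cdot>\<^sub>m T_mat n) (complex_of_real s \<cdot>\<^sub>m T_mat n) = r * s * real n * real (n + 1)"
proof -
  have "B0 (complex_of_real r \<cdot>\<^sub>m T_mat n) (complex_of_real s \<cdot>\<^sub>m T_mat n) =
    - (\<Sum>i<n+1. \<Sum>j<n+1. Re ((complex_of_real r \<cdot>\<^sub>m T_mat n) $$ (i,j) * (complex_of_real s \<cdot>\<^sub>m T_mat n) $$ (j,i)))"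
    by (rule B0_eq) (auto simp: T_mat_eq)
  also have "\<dots> = - (\<Sum>i<n+1. \<Sum>j<n+1. if i = j then (if i = 0 then - r * s * real n * real n else - r * s) else 0)"
    by (intro arg_cong[of _ _ uminus] sum.cong) (auto simp: T_mat_eq)
  also have "\<dots> = r * s * real n * real (n + 1)"
    by (simp add: sum.delta sum.lessThan_Suc_shift del: sum.lessThan_Suc) (simp add: algebra_simps)
  finally show ?thesis .
qed

lemma reductive_complement_eq:
  assumes "n \<ge> 1"
  shows "reductive_complement n = {X1 + X2 | X1 X2. X1 \<in> m1 n \<and> X2 \<in> m2 n}"
proof (intro equalityI subsetI)
  fix X assume "X \<in> {X1 + X2 | X1 X2. X1 \<in> m1 n \<and> X2 \<in> m2 n}"
  then obtain r X2 where X: "X = complex_of_real r \<cdot>\<^sub>m T_mat n + X2" and X2: "X2 \<in> m2 n"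
    by (auto simp: m1_eq)
  have c2: "X2 \<in> carrier_mat (n+1) (n+1)" using X2 by (simp add: m2_eq)
  then have c: "X \<in> carrier_mat (n+1) (n+1)" by (simp add: X)
  have e: "X $$ (0,0) = - (r * of_nat n * \<i>)"
    "\<And>k. k < n \<Longrightarrow> X $$ (Suc k, Suc k) = r * \<i>"
    "\<And>k l. k < n \<Longrightarrow> l < n \<Longrightarrow> k \<noteq> l \<Longrightarrow> X $$ (Suc k, Suc l) = 0"
    "\<And>k. k < n \<Longrightarrow> X $$ (0, Suc k) = - cnj (X $$ (Suc k, 0))"
    using X2 c2 by (auto simp: X m2_eq T_mat_eq)
  have "X \<in> su (n + 1)"
    unfolding su_iff
  proof (intro conjI allI impI c)
    fix i j assume "i < n + 1" "j < n + 1"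
    then show "X $$ (i, j) = - cnj (X $$ (j, i))"
      by (cases i; cases j; cases "i = j"; simp add: e)
  next
    show "(\<Sum>i<n+1. X $$ (i,i)) = 0"
      by (simp add: sum.lessThan_Suc_shift e del: sum.lessThan_Suc)
  qed
  moreover have "B0 X Y = 0" if "Y \<in> isotropy_algebra n" for Y
  proof -
    have Y: "Y \<in> carrier_mat (n+1) (n+1)" "\<And>k. k \<le> n \<Longrightarrow> Y $$ (0,k) = 0"
      "\<And>k. k \<le> n \<Longrightarrow> Y $$ (k,0) = 0" "(\<Sum>i<n. Y $$ (Suc i, Suc i)) = 0"
    proof -
      show "Y \<in> carrier_mat (n+1) (n+1)" using that unfolding isotropy_algebra_iff su_iff by blast
      show z: "Y $$ (0,k) = 0" "Y $$ (k,0) = 0" if "k \<le> n" for k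
        using \<open>Y \<in> isotropy_algebra n\<close> that unfolding isotropy_algebra_iff by blast+
      have "(\<Sum>i<n+1. Y $$ (i, i)) = 0" using that unfolding isotropy_algebra_iff su_iff by blast
      then show "(\<Sum>i<n. Y $$ (Suc i, Suc i)) = 0"
        by (simp add: sum.lessThan_Suc_shift z del: sum.lessThan_Suc)
    qed
    have "B0 X Y = - (\<Sum>i<n+1. \<Sum>j<n+1. Re (X $$ (i,j) * Y $$ (j,i)))"
      by (rule B0_eq) (use c Y in auto)
    also have "\<dots> = - (\<Sum>i<n. \<Sum>j<n. Re (X $$ (Suc i,Suc j) * Y $$ (Suc j,Suc i)))"
      by (simp add: sum.lessThan_Suc_shift Y del: sum.lessThan_Suc)
    also have "\<dots> = - (\<Sum>i<n. \<Sum>j<n. if i = j then Re (r * \<i> * Y $$ (Suc i,Suc i)) else 0)"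
      by (intro arg_cong[of _ _ uminus] sum.cong) (auto simp: e)
    also have "\<dots> = - Re (r * \<i> * (\<Sum>i<n. Y $$ (Suc i, Suc i)))"
      by (simp add: sum_distrib_left Re_sum del: Re_complex_of_real)
    finally show ?thesis by (simp add: Y)
  qed
  ultimately show "X \<in> reductive_complement n" by (simp add: reductive_complement_def)
next
  fix X assume "X \<in> reductive_complement n"
  then have su: "X \<in> su (n+1)" and orth: "\<And>Y. Y \<in> isotropy_algebra n \<Longrightarrow> B0 X Y = 0"
    by (auto simp: reductive_complement_def)
  have c: "X \<in> carrier_mat (n+1) (n+1)" and skew: "\<And>i j. i \<le> n \<Longrightarrow> j \<le> n \<Longrightarrow> X $$ (i,j) = - cnj (X $$ (j,i))"
    and tr: "X $$ (0,0) = - (\<Sum>i<n. X $$ (Suc i, Suc i))"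
  proof -
    show "X \<in> carrier_mat (n+1) (n+1)" using su unfolding su_iff by blast
    show "X $$ (i,j) = - cnj (X $$ (j,i))" if "i \<le> n" "j \<le> n" for i j
      using su that unfolding su_iff by (metis less_add_one order_le_less_trans)
    have "(\<Sum>i<n+1. X $$ (i, i)) = 0" using su unfolding su_iff by blast
    then show "X $$ (0,0) = - (\<Sum>i<n. X $$ (Suc i, Suc i))"
      by (simp add: sum.lessThan_Suc_shift eq_neg_iff_add_eq_0 del: sum.lessThan_Suc)
  qed
  have off: "X $$ (k,l) = 0" if kl: "k \<in> {1..n}" "l \<in> {1..n}" "k \<noteq> l" for k l
  proof -
    define z where "z = X $$ (k,l)"
    let ?Y = "mat (n+1) (n+1) (\<lambda>(i,j). if (i,j) = (k,l) then z else if (i,j) = (l,k) then - cnj z else 0)"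
    have "?Y \<in> isotropy_algebra n" unfolding isotropy_algebra_iff su_iff
      using kl by (auto intro!: sum.neutral)
    then have "B0 X ?Y = 0" by (rule orth)
    moreover have "B0 X ?Y = - (\<Sum>i<n+1. \<Sum>j<n+1. Re (X $$ (i,j) * ?Y $$ (j,i)))"
      by (rule B0_eq) (use c in auto)
    moreover have "(\<Sum>i<n+1. \<Sum>j<n+1. Re (X $$ (i,j) * ?Y $$ (j,i))) = 
       (\<Sum>i<n+1. \<Sum>j<n+1. (if j = k then if i = l then Re (X $$ (l,k) * z) else 0 else 0)
          + (if j = l then if i = k then Re (X $$ (k,l) * - cnj z) else 0 else 0))"
      by (intro sum.cong) (use kl in auto)
    moreover have "\<dots> = Re (X $$ (l,k) * z) + Re (X $$ (k,l) * - cnj z)"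
      using kl by (simp only: sum.distrib) (simp add: sum.delta)
    ultimately have "Re (X $$ (l,k) * z) + Re (X $$ (k,l) * - cnj z) = 0" by linarith
    moreover have "X $$ (l,k) = - cnj z" using skew[of l k] kl by (simp add: z_def)
    ultimately have "Re (- cnj z * z) + Re (z * - cnj z) = 0" by (simp only: z_def)
    moreover have eq: "Re (- cnj z * z) + Re (z * - cnj z) = - 2 * ((Re z)\<^sup>2 + (Im z)\<^sup>2)"
      by (simp add: power2_eq_square)
    ultimately have "- 2 * ((Re z)\<^sup>2 + (Im z)\<^sup>2) = 0" by (simp only:)
    then have "Re z = 0 \<and> Im z = 0"
      by (simp only: mult_eq_0_iff neg_equal_0_iff_equal zero_neq_numeral sum_power2_eq_zero_iff) simp
    then show ?thesis by (simp add: z_def complex_eq_iff)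
  qed
  define r where "r = Im (X $$ (1,1))"
  have re0: "Re (X $$ (k,k)) = 0" if "k \<le> n" for k
    using arg_cong[OF skew[OF that that], of Re] by simp
  have diag: "X $$ (k,k) = r * \<i>" if k: "k \<in> {1..n}" for k
  proof (cases "k = 1")
    case True
    then show ?thesis using re0[of k] k by (simp add: r_def complex_eq_iff)
  next
    case False
    let ?Y = "mat (n+1) (n+1) (\<lambda>(i,j). if (i,j) = (k,k) then \<i> else if (i,j) = (1,1) then - \<i> else 0)"
    have "(\<Sum>i<n+1. ?Y $$ (i,i)) = (\<Sum>i<n+1. (if i = k then \<i> else 0) + (if i = 1 then - \<i> else 0))"
      by (rule sum.cong) (use False in auto)
    also have "\<dots> = 0" using k assms by (simp only: sum.distrib) (simp add: sum.delta)
    finally have "?Y \<in> isotropy_algebra n" unfolding isotropy_algebra_iff su_iff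
      using k by auto
    then have "B0 X ?Y = 0" by (rule orth)
    moreover have "B0 X ?Y = - (\<Sum>i<n+1. \<Sum>j<n+1. Re (X $$ (i,j) * ?Y $$ (j,i)))"
      by (rule B0_eq) (use c in auto)
    moreover have "(\<Sum>i<n+1. \<Sum>j<n+1. Re (X $$ (i,j) * ?Y $$ (j,i))) = 
       (\<Sum>i<n+1. \<Sum>j<n+1. (if j = k then if i = k then Re (X $$ (k,k) * \<i>) else 0 else 0)
          + (if j = 1 then if i = 1 then Re (X $$ (1,1) * - \<i>) else 0 else 0))"
      by (intro sum.cong) (use False in auto)
    moreover have "\<dots> = Re (X $$ (k,k) * \<i>) + Re (X $$ (1,1) * - \<i>)"
      using k assms by (simp only: sum.distrib) (simp add: sum.delta)
    ultimately have "Re (X $$ (k,k) * \<i>) + Re (X $$ (1,1) * - \<i>) = 0" by linarith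
    then have "Im (X $$ (k,k)) = r" by (simp add: r_def)
    then show ?thesis using re0[of k] k by (simp add: complex_eq_iff)
  qed
  let ?X2 = "mat (n+1) (n+1) (\<lambda>(i,j). if (i = 0) \<noteq> (j = 0) then X $$ (i,j) else 0)"
  have X00: "X $$ (0,0) = - (of_nat n * (r * \<i>))"
    unfolding tr by (simp add: diag)
  have "X = complex_of_real r \<cdot>\<^sub>m T_mat n + ?X2"
  proof (rule eq_matI, goal_cases)
    case (1 i j)
    then show ?case using off[of i j] diag[of i] X00 by (auto simp: T_mat_eq)
  qed (use c in \<open>auto simp: T_mat_eq\<close>)
  moreover have "?X2 \<in> m2 n"
    using skew[of 0] by (simp add: m2_eq)
  ultimately show "X \<in> {X1 + X2 | X1 X2. X1 \<in> m1 n \<and> X2 \<in> m2 n}"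
    by (auto simp: m1_eq)
qed

lemma basis_vec_in_m:
  assumes "k \<in> {1..2 * n + 1}"
  shows "k = 1 \<Longrightarrow> basis_vec n a b k \<in> m1 n" "k \<noteq> 1 \<Longrightarrow> basis_vec n a b k \<in> m2 n"
proof -
  assume "k = 1"
  then have "basis_vec n a b k = complex_of_real (1 / sqrt (a * real n * real (n + 1))) \<cdot>\<^sub>m T_mat n"
    by (simp add: basis_vec_def)
  then show "basis_vec n a b k \<in> m1 n" unfolding m1_eq by blast
next
  assume "k \<noteq> 1"
  then have "k div 2 \<in> {1..n}" using assms by auto
  then show "basis_vec n a b k \<in> m2 n"
    using \<open>k \<noteq> 1\<close> by (auto simp: basis_vec_def m2_eq E_mat_def F_mat_def)
qed

lemma basis_vec_orthonormal:
  assumes "n \<ge> 1" "a > 0" "b > 0" "i \<in> {1..2 * n + 1}" "j \<in> {1..2 * n + 1}"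
  shows "metric n a b (basis_vec n a b i) (basis_vec n a b j) = (if i = j then 1 else 0)"
proof -
  let ?e = "basis_vec n a b" and ?O = "0\<^sub>m (n+1) (n+1) :: complex mat"
  have B00: "B0 ?O X = 0" "B0 X ?O = 0" if "X \<in> carrier_mat (n+1) (n+1)" for X
    using that by (simp_all add: B0_eq[of _ "n+1"])
  have p1: "m1_part n X = X" "m2_part n X = ?O" if "X \<in> m1 n" for X
  proof -
    have "X \<in> carrier_mat (n+1) (n+1)" using that by (auto simp: m1_eq T_mat_eq)
    then have "X + ?O = X" by (rule right_add_zero_mat)
    then show "m1_part n X = X" "m2_part n X = ?O"
      using m1_part_add[OF that zero_in_m(2) assms(1)] by auto
  qed
  have p2: "m1_part n X = ?O" "m2_part n X = X" if "X \<in> m2 n" for X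
  proof -
    have "X \<in> carrier_mat (n+1) (n+1)" using that by (auto simp: m2_eq)
    then have "?O + X = X" by (rule left_add_zero_mat)
    then show "m1_part n X = ?O" "m2_part n X = X"
      using m1_part_add[OF zero_in_m(1) that assms(1)] by auto
  qed
  have c: "?e k \<in> carrier_mat (n+1) (n+1)" for k
    by (auto simp: basis_vec_def T_mat_eq E_mat_def F_mat_def)
  consider "i = 1" "j = 1" | "i = 1" "j \<noteq> 1" | "i \<noteq> 1" "j = 1" | "i \<noteq> 1" "j \<noteq> 1" by blast
  then show ?thesis
  proof cases
    case 1
    have "metric n a b (?e 1) (?e 1) = a * B0 (?e 1) (?e 1)"
      unfolding metric_def using p1[OF basis_vec_in_m(1)[of 1 n a b]] B00 by simp
    also have "\<dots> = 1"
    proof -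
      have "a * real n * real (n + 1) > 0" using assms by simp
      then show ?thesis
        unfolding basis_vec_def if_True simp_thms B0_T by (simp add: field_simps)
    qed
    finally show ?thesis using 1 by simp
  next
    case 2
    then show ?thesis unfolding metric_def
      using p1[OF basis_vec_in_m(1)[of i n a b]] p2[OF basis_vec_in_m(2)[of j n a b]] assms B00 c by simp
  next
    case 3
    then show ?thesis unfolding metric_def
      using p1[OF basis_vec_in_m(1)[of j n a b]] p2[OF basis_vec_in_m(2)[of i n a b]] assms B00 c by simp
  next
    case 4
    have "metric n a b (?e i) (?e j) = b * B0 (?e i) (?e j)"
      unfolding metric_def
      using p2[OF basis_vec_in_m(2)[of i n a b]] p2[OF basis_vec_in_m(2)[of j n a b]] assms 4 B00 c by simp
    also have "B0 (?e i) (?e j) = 2 * (\<Sum>k\<in>{1..n}. Re (?e i $$ (k,0) * cnj (?e j $$ (k,0))))"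
      by (rule B0_m2) (use basis_vec_in_m(2) assms 4 in auto)
    also have "(\<Sum>k\<in>{1..n}. Re (?e i $$ (k,0) * cnj (?e j $$ (k,0)))) =
      (\<Sum>k\<in>{1..n}. if k = i div 2 then if i = j then 1 / (2 * b) else 0 else 0)"
    proof (rule sum.cong)
      fix k assume k: "k \<in> {1..n}"
      define s where "s = 1 / sqrt (2 * b)"
      have s: "s * s = 1 / (2 * b)" using assms by (simp add: s_def)
      have e: "?e q $$ (k,0) =
          (if k = q div 2 then if even q then complex_of_real s else \<i> * complex_of_real s else 0)"
        if "q \<noteq> 1" for q
        using that k by (auto simp: basis_vec_def E_mat_def F_mat_def s_def)
      have "i = j" if "i div 2 = j div 2" "even i = even j" using that by presburger
      then show "Re (?e i $$ (k,0) * cnj (?e j $$ (k,0))) =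
          (if k = i div 2 then if i = j then 1 / (2 * b) else 0 else 0)"
        unfolding e[OF 4(1)] e[OF 4(2)] by (cases "even i"; cases "even j") (auto simp: s)
    qed simp
    also have "b * (2 * \<dots>) = (if i = j then 1 else 0)"
    proof -
      have "i div 2 \<in> {1..n}" using 4 assms by auto
      then show ?thesis using assms by (auto simp: sum.delta)
    qed
    finally show ?thesis .
  qed
qed


section \<open>The spin module\<close>

(* An element of the exterior algebra on y_1, ..., y_n is given by its coordinates: the value
   at I = {i_1 < ... < i_k} is the coefficient of y_{i_1} wedge ... wedge y_{i_k}. *)
type_synonym spinor = "nat set \<Rightarrow> complex"

definition spinor_scale :: "complex \<Rightarrow> spinor \<Rightarrow> spinor" where
  "spinor_scale c \<eta> = (\<lambda>I. c * \<eta> I)"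

interpretation spinor: vector_space spinor_scale
  by unfold_locales (auto simp: spinor_scale_def fun_eq_iff algebra_simps)

definition spin_module :: "nat \<Rightarrow> spinor set" where
  "spin_module n = {\<eta>. \<forall>I. \<eta> I \<noteq> 0 \<longrightarrow> I \<subseteq> {1..n}}"

definition ext_one :: spinor where
  "ext_one = (\<lambda>I. if I = {} then 1 else 0)"

definition y_gen :: "nat \<Rightarrow> spinor" where
  "y_gen j = (\<lambda>I. if I = {j} then 1 else 0)"

definition shuffle_sign :: "nat set \<Rightarrow> nat set \<Rightarrow> complex" where
  "shuffle_sign I J = (-1) ^ card {(i, j). i \<in> I \<and> j \<in> J \<and> j < i}"

definition wedge :: "spinor \<Rightarrow> spinor \<Rightarrow> spinor" (infixr "\<and>\<^sub>\<Sigma>" 70) where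
  "\<alpha> \<and>\<^sub>\<Sigma> \<beta> = (\<lambda>K. \<Sum>I\<in>Pow K. shuffle_sign I (K - I) * \<alpha> I * \<beta> (K - I))"

(* Contraction with x_j, where x_j is dual to y_j. The lemmas contract_one and contract_y_wedge
   below characterise it as the antiderivation sending y_k to delta_{jk}. *)
definition contract :: "nat \<Rightarrow> spinor \<Rightarrow> spinor" where
  "contract j \<eta> = (\<lambda>I. if j \<in> I then 0 else (-1) ^ card {i \<in> I. i < j} * \<eta> (insert j I))"

definition clifford :: "nat \<Rightarrow> spinor \<Rightarrow> spinor" where
  "clifford k \<eta> =
     (if k = 1 then (\<lambda>I. (if even (card I) then \<i> else - \<i>) * \<eta> I)
      else if even k then spinor_scale \<i> (contract (k div 2) \<eta> + y_gen (k div 2) \<and>\<^sub>\<Sigma> \<eta>)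
      else y_gen (k div 2) \<and>\<^sub>\<Sigma> \<eta> - contract (k div 2) \<eta>)"

(* Spin lift of a skew endomorphism A of the reductive complement. In the convention in which
   e_i wedge e_j maps e_i to e_j and e_j to - e_i, one has
   A = sum_{i<j} g(A e_i, e_j) e_i wedge e_j, and e_i wedge e_j lifts to (1/2) e_i . e_j. *)
definition spin_lift ::
    "nat \<Rightarrow> real \<Rightarrow> real \<Rightarrow> (complex mat \<Rightarrow> complex mat) \<Rightarrow> spinor \<Rightarrow> spinor" where
  "spin_lift n a b A \<eta> =
     (\<Sum>j\<in>{1..2 * n + 1}. \<Sum>i\<in>{1..<j}.
        spinor_scale
          (complex_of_real (metric n a b (A (basis_vec n a b i)) (basis_vec n a b j)) * (1 / 2))
          (clifford i (clifford j \<eta>)))"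

(* Since SU(n) is connected, a constant map into the spin module is SU(n)-equivariant iff its
   value is annihilated by the spin lift of the isotropy representation of su(n). *)
definition invariant_spinors :: "nat \<Rightarrow> real \<Rightarrow> real \<Rightarrow> spinor set" where
  "invariant_spinors n a b =
     {\<psi> \<in> spin_module n. \<forall>h \<in> isotropy_algebra n. spin_lift n a b (ad h) \<psi> = 0}"

definition psi_plus :: spinor where
  "psi_plus = ext_one"

definition psi_minus :: "nat \<Rightarrow> spinor" where
  "psi_minus n = foldr (\<lambda>j \<eta>. y_gen j \<and>\<^sub>\<Sigma> \<eta>) [1..<n + 1] ext_one"

lemma y_wedge:
  "(y_gen k \<and>\<^sub>\<Sigma> \<eta>) K =
     (if finite K \<and> k \<in> K then (-1) ^ card {i \<in> K. i < k} * \<eta> (K - {k}) else 0)"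
proof (cases "finite K")
  case True
  have "(y_gen k \<and>\<^sub>\<Sigma> \<eta>) K = (\<Sum>I\<in>Pow K. if I = {k} then shuffle_sign {k} (K - {k}) * \<eta> (K - {k}) else 0)"
    unfolding wedge_def y_gen_def by (rule sum.cong) auto
  also have "\<dots> = (if k \<in> K then shuffle_sign {k} (K - {k}) * \<eta> (K - {k}) else 0)"
    using True by (simp add: sum.delta)
  also have "{(i, j). i \<in> {k} \<and> j \<in> K - {k} \<and> j < i} = Pair k ` {i \<in> K. i < k}"
    by auto
  hence "shuffle_sign {k} (K - {k}) = (-1) ^ card {i \<in> K. i < k}"
    unfolding shuffle_sign_def by (simp add: card_image inj_on_def)
  finally show ?thesis using True by simp
next
  case False
  then show ?thesis by (simp add: wedge_def)
qed

lemma contract_one: "contract j ext_one = 0"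
  by (auto simp: contract_def ext_one_def fun_eq_iff)

lemma contract_y_wedge:
  assumes "\<eta> \<in> spin_module n"
  shows "contract j (y_gen k \<and>\<^sub>\<Sigma> \<eta>) = (if j = k then \<eta> else 0) - y_gen k \<and>\<^sub>\<Sigma> contract j \<eta>"
proof
  fix I
  have inf: "\<eta> J = 0" if "infinite J" for J
    using assms that finite_subset unfolding spin_module_def by fastforce
  show "contract j (y_gen k \<and>\<^sub>\<Sigma> \<eta>) I = ((if j = k then \<eta> else 0) - y_gen k \<and>\<^sub>\<Sigma> contract j \<eta>) I"
  proof (cases "finite I")
    case False
    then show ?thesis by (simp add: contract_def y_wedge inf)
  next
    case fin: True
    consider (same) "j = k" | (lt) "j < k" | (gt) "k < j" by linarith
    then show ?thesis
    proof cases
      case same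
      have "{i. (i = k \<or> i \<in> I) \<and> i < k} = {i \<in> I. i < k}" by auto
      moreover have "{i \<in> I. i \<noteq> k \<and> i < k} = {i \<in> I. i < k}" by auto
      ultimately show ?thesis using same fin
        by (auto simp: contract_def y_wedge insert_absorb simp flip: power_add mult.assoc)
    next
      case lt
      have "card {i. (i = j \<or> i \<in> I) \<and> i < k} = Suc (card {i \<in> I. i < k})" if "j \<notin> I"
      proof -
        have "{i. (i = j \<or> i \<in> I) \<and> i < k} = insert j {i \<in> I. i < k}" using lt by auto
        then show ?thesis using that fin by simp
      qed
      moreover have "{i \<in> I. i \<noteq> k \<and> i < j} = {i \<in> I. i < j}" using lt by auto
      moreover have "insert j I - {k} = insert j (I - {k})" using lt by auto
      ultimately show ?thesis using lt fin
        by (auto simp: contract_def y_wedge conj_assoc)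
    next
      case gt
      have "{i. (i = j \<or> i \<in> I) \<and> i < k} = {i \<in> I. i < k}" using gt by auto
      moreover have "card {i \<in> I. i < j} = Suc (card {i \<in> I. i \<noteq> k \<and> i < j})" if "k \<in> I"
      proof -
        have "{i \<in> I. i < j} = insert k {i \<in> I. i \<noteq> k \<and> i < j}" using gt that by auto
        then show ?thesis using fin by simp
      qed
      moreover have "insert j I - {k} = insert j (I - {k})" using gt by auto
      ultimately show ?thesis using gt fin
        by (auto simp: contract_def y_wedge conj_assoc)
    qed
  qed
qed

end

theory Submission
  imports Defs
begin

text \<open>
  Write \<open>w\<^sub>p\<close> for the exterior product with \<open>y\<^sub>p\<close> and \<open>c\<^sub>q\<close> for the contraction with \<open>x\<^sub>q\<close>.
  An element \<open>h\<close> of the isotropy algebra is a traceless skew-Hermitian block. Its adjoint action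
  kills \<open>e\<^sub>1\<close>, because \<open>e\<^sub>1\<close> is a scalar matrix on that block, and is the standard representation on
  the first column of a matrix, which identifies \<open>m2 n\<close> with \<open>\<complex>\<^sup>n\<close>. The map of \<open>\<complex>\<^sup>n\<close> being
  complex linear, all terms \<open>w\<^sub>p w\<^sub>q\<close> and \<open>c\<^sub>p c\<^sub>q\<close> of its spin lift cancel, and the anticommutation
  relations turn what remains into half the trace of \<open>h\<close> minus \<open>\<Sum> h\<^sub>q\<^sub>p w\<^sub>p c\<^sub>q\<close>. The trace vanishes, so
  the spin lift is the natural action of \<open>su n\<close> on the exterior algebra by derivations: this is
  \<open>spin_lift_isotropy\<close>. The parameter \<open>b\<close> of the metric cancels against the normalisation of the
  basis, and \<open>a\<close> enters only through \<open>e\<^sub>1\<close>.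

  The diagonal part of the algebra suffices to find the invariants. The product of \<open>y\<^sub>i\<close> over
  \<open>i \<in> K\<close> is a weight vector: the diagonal matrix with entries \<open>\<i>\<close> at \<open>p\<close> and \<open>- \<i>\<close> at \<open>q\<close> multiplies it
  by zero if \<open>K\<close> contains both or neither of \<open>p\<close> and \<open>q\<close>, and by \<open>\<i>\<close> or \<open>- \<i>\<close> otherwise. So a monomial occurring in an invariant spinor contains all generators or
  none. Conversely, for \<open>p \<noteq> q\<close> the operator \<open>w\<^sub>p c\<^sub>q\<close> kills both the empty and the full product, and
  the terms with \<open>p = q\<close> add up to the trace of \<open>h\<close> on the full one and to zero on the empty one.
  Hence invariance means being supported on these two index sets (\<open>invariant_spinors_iff\<close>).
\<close>


section \<open>Sums over pairs of indices\<close>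

lemma sum_split_parity:
  fixes F :: "nat \<Rightarrow> 'a::comm_monoid_add"
  assumes "m \<ge> 1"
  shows "(\<Sum>i\<in>{1..<2 * m}. F i) = F 1 + (\<Sum>p\<in>{1..<m}. F (2 * p) + F (2 * p + 1))"
  using assms
proof (induction m rule: dec_induct)
  case base
  have "{1..<2 * 1} = {1::nat}" by auto
  then show ?case by simp
next
  case (step m)
  have "{1..<2 * Suc m} = insert (2 * m + 1) (insert (2 * m) {1..<2 * m})"
    using step.hyps by auto
  then have "(\<Sum>i\<in>{1..<2 * Suc m}. F i) = F (2 * m + 1) + (F (2 * m) + (\<Sum>i\<in>{1..<2 * m}. F i))"
    by simp
  also have "{1..<Suc m} = insert m {1..<m}" using step.hyps by auto
  then have "F (2 * m + 1) + (F (2 * m) + (\<Sum>i\<in>{1..<2 * m}. F i)) =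
      F 1 + (\<Sum>p\<in>{1..<Suc m}. F (2 * p) + F (2 * p + 1))"
    unfolding step.IH by (simp add: ac_simps)
  finally show ?case .
qed

text \<open>
  The spin lift sums over increasing pairs of real basis indices, whereas the complex structure
  pairs \<open>2 * p\<close> with \<open>2 * p + 1\<close> and leaves the index 1, which the isotropy kills, alone. Grouping by complex index leaves one term on each complex line and
  four terms for each increasing pair of lines.
\<close>

lemma sum_increasing_pairs_split_parity:
  fixes f :: "nat \<Rightarrow> nat \<Rightarrow> 'a::comm_monoid_add"
  assumes f1: "\<And>j. j \<in> {2..2 * n + 1} \<Longrightarrow> f 1 j = 0"
  shows "(\<Sum>j\<in>{1..2 * n + 1}. \<Sum>i\<in>{1..<j}. f i j) =
    (\<Sum>q\<in>{1..n}. f (2 * q) (2 * q + 1) + (\<Sum>p\<in>{1..<q}.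
        f (2 * p) (2 * q) + f (2 * p) (2 * q + 1)
        + f (2 * p + 1) (2 * q) + f (2 * p + 1) (2 * q + 1)))"
proof -
  have col: "(\<Sum>i\<in>{1..<2 * q}. f i j) = (\<Sum>p\<in>{1..<q}. f (2 * p) j + f (2 * p + 1) j)"
    if "q \<ge> 1" "j \<in> {2..2 * n + 1}" for q j
    using sum_split_parity[OF that(1), of "\<lambda>i. f i j"] f1[OF that(2)] by simp
  have "{1..2 * n + 1} = {1..<2 * (n + 1)}" by auto
  then have "(\<Sum>j\<in>{1..2 * n + 1}. \<Sum>i\<in>{1..<j}. f i j) =
      (\<Sum>q\<in>{1..<n + 1}. (\<Sum>i\<in>{1..<2 * q}. f i (2 * q)) + (\<Sum>i\<in>{1..<2 * q + 1}. f i (2 * q + 1)))"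
    using sum_split_parity[of "n + 1" "\<lambda>j. \<Sum>i\<in>{1..<j}. f i j"] by simp
  also have "\<dots> = (\<Sum>q\<in>{1..n}. f (2 * q) (2 * q + 1) + (\<Sum>p\<in>{1..<q}.
        f (2 * p) (2 * q) + f (2 * p) (2 * q + 1)
        + f (2 * p + 1) (2 * q) + f (2 * p + 1) (2 * q + 1)))"
  proof (rule sum.cong)
    fix q assume "q \<in> {1..n}"
    then have q: "q \<ge> 1" "2 * q \<in> {2..2 * n + 1}" "2 * q + 1 \<in> {2..2 * n + 1}" by auto
    have "{1..<2 * q + 1} = insert (2 * q) {1..<2 * q}" using q by auto
    then have "(\<Sum>i\<in>{1..<2 * q + 1}. f i (2 * q + 1)) =
        f (2 * q) (2 * q + 1) + (\<Sum>i\<in>{1..<2 * q}. f i (2 * q + 1))"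
      by simp
    then show "(\<Sum>i\<in>{1..<2 * q}. f i (2 * q)) + (\<Sum>i\<in>{1..<2 * q + 1}. f i (2 * q + 1)) =
      f (2 * q) (2 * q + 1) + (\<Sum>p\<in>{1..<q}.
        f (2 * p) (2 * q) + f (2 * p) (2 * q + 1)
        + f (2 * p + 1) (2 * q) + f (2 * p + 1) (2 * q + 1))"
      by (simp only: col[OF q(1,2)] col[OF q(1,3)]) (simp add: sum.distrib ac_simps)
  qed auto
  finally show ?thesis .
qed

lemma sum_square_by_triangles:
  fixes D :: "nat \<Rightarrow> nat \<Rightarrow> 'a::comm_monoid_add"
  shows "(\<Sum>p\<in>{1..n}. \<Sum>q\<in>{1..n}. D p q) =
    (\<Sum>q\<in>{1..n}. D q q + (\<Sum>p\<in>{1..<q}. D p q + D q p))"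
proof (induction n)
  case (Suc n)
  have "{1..<Suc n} = {1..n}" by auto
  then show ?case using Suc by (simp add: sum.distrib ac_simps)
qed simp


section \<open>Clifford multiplication in terms of creation and annihilation operators\<close>

lemma contract_add: "contract j (\<alpha> + \<beta>) = contract j \<alpha> + contract j \<beta>"
  by (auto simp: contract_def fun_eq_iff algebra_simps)

lemma contract_diff: "contract j (\<alpha> - \<beta>) = contract j \<alpha> - contract j \<beta>"
  by (auto simp: contract_def fun_eq_iff algebra_simps)

lemma contract_scale: "contract j (spinor_scale c \<alpha>) = spinor_scale c (contract j \<alpha>)"
  by (auto simp: contract_def spinor_scale_def fun_eq_iff)

lemma y_wedge_add: "y_gen j \<and>\<^sub>\<Sigma> (\<alpha> + \<beta>) = y_gen j \<and>\<^sub>\<Sigma> \<alpha> + y_gen j \<and>\<^sub>\<Sigma> \<beta>"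
  by (auto simp: y_wedge fun_eq_iff algebra_simps)

lemma y_wedge_diff: "y_gen j \<and>\<^sub>\<Sigma> (\<alpha> - \<beta>) = y_gen j \<and>\<^sub>\<Sigma> \<alpha> - y_gen j \<and>\<^sub>\<Sigma> \<beta>"
  by (auto simp: y_wedge fun_eq_iff algebra_simps)

lemma y_wedge_scale: "y_gen j \<and>\<^sub>\<Sigma> spinor_scale c \<alpha> = spinor_scale c (y_gen j \<and>\<^sub>\<Sigma> \<alpha>)"
  by (auto simp: y_wedge spinor_scale_def fun_eq_iff)

lemma contract_contract_same: "contract j (contract j \<eta>) = 0"
  by (auto simp: contract_def fun_eq_iff)

lemma y_wedge_y_wedge_same: "y_gen j \<and>\<^sub>\<Sigma> (y_gen j \<and>\<^sub>\<Sigma> \<eta>) = 0"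
  by (auto simp: y_wedge fun_eq_iff)

lemmas creation_annihilation_linear =
  contract_add contract_diff contract_scale y_wedge_add y_wedge_diff y_wedge_scale

lemma clifford_even:
  "clifford (2 * p) \<eta> = spinor_scale \<i> (contract p \<eta> + y_gen p \<and>\<^sub>\<Sigma> \<eta>)"
  by (simp add: clifford_def)

lemma clifford_odd:
  assumes "p \<ge> 1"
  shows "clifford (2 * p + 1) \<eta> = y_gen p \<and>\<^sub>\<Sigma> \<eta> - contract p \<eta>"
  using assms by (simp add: clifford_def)

text \<open>
  The coefficients are those of the real matrix of multiplication by \<open>z\<close>, sending the complex line
  \<open>p\<close> to the line \<open>q\<close>. Complex linearity makes the two products of equal type (two creations or two
  annihilations) cancel.
\<close>

lemma complex_linear_pair_clifford:
  assumes "p \<ge> 1" "q \<ge> 1"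
  shows "of_real (Re z) * (1 / 2) * clifford (2 * p) (clifford (2 * q) \<eta>) K
       + of_real (Im z) * (1 / 2) * clifford (2 * p) (clifford (2 * q + 1) \<eta>) K
       + of_real (- Im z) * (1 / 2) * clifford (2 * p + 1) (clifford (2 * q) \<eta>) K
       + of_real (Re z) * (1 / 2) * clifford (2 * p + 1) (clifford (2 * q + 1) \<eta>) K
     = - cnj z * contract p (y_gen q \<and>\<^sub>\<Sigma> \<eta>) K - z * (y_gen p \<and>\<^sub>\<Sigma> contract q \<eta>) K"
proof -
  obtain r s where z: "z = of_real r + \<i> * of_real s" "Re z = r" "Im z = s"
    using complex_eq[of z] by (metis mult.commute)
  have cz: "cnj z = of_real r - \<i> * of_real s" by (simp add: z)
  have ii: "\<i> * (\<i> * x) = - x" for x by (simp flip: mult.assoc)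
  show ?thesis
    unfolding cz z(2,3) unfolding z(1) clifford_even clifford_odd[OF assms(1)] clifford_odd[OF assms(2)]
    by (simp add: creation_annihilation_linear)
      (simp add: spinor_scale_def ii field_simps)
qed

text \<open>
  Two basis vectors on the same line do not contribute a pure product of creation and annihilation:
  normal ordering produces the extra scalar that is responsible for the trace in the spin lift.
\<close>

lemma clifford_complex_line:
  assumes "p \<ge> 1" "\<eta> \<in> spin_module n"
  shows "clifford (2 * p) (clifford (2 * p + 1) \<eta>) =
    spinor_scale \<i> (\<eta> - spinor_scale 2 (y_gen p \<and>\<^sub>\<Sigma> contract p \<eta>))"
  unfolding clifford_even clifford_odd[OF assms(1)]
  by (simp add: creation_annihilation_linear contract_contract_same y_wedge_y_wedge_same
      contract_y_wedge[OF assms(2)])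
    (simp add: spinor_scale_def fun_eq_iff algebra_simps)


section \<open>The isotropy representation\<close>

lemma isotropy_algebraD:
  assumes "h \<in> isotropy_algebra n"
  shows "h \<in> carrier_mat (n + 1) (n + 1)"
    and "\<And>k. k \<le> n \<Longrightarrow> h $$ (0, k) = 0" and "\<And>k. k \<le> n \<Longrightarrow> h $$ (k, 0) = 0"
    and "\<And>k l. k \<le> n \<Longrightarrow> l \<le> n \<Longrightarrow> h $$ (k, l) = - cnj (h $$ (l, k))"
    and "(\<Sum>k\<in>{1..n}. h $$ (k, k)) = 0"
proof -
  have su: "h \<in> su (n + 1)" and z: "\<forall>k\<le>n. h $$ (0, k) = 0 \<and> h $$ (k, 0) = 0"
    using assms unfolding isotropy_algebra_iff by blast+
  show "h \<in> carrier_mat (n + 1) (n + 1)" using su unfolding su_iff by blast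
  show "h $$ (k, l) = - cnj (h $$ (l, k))" if "k \<le> n" "l \<le> n" for k l
    using su that unfolding su_iff by (metis less_add_one order_le_less_trans)
  show "h $$ (0, k) = 0" "h $$ (k, 0) = 0" if "k \<le> n" for k
    using z that by auto
  have "{..<n + 1} = insert 0 {1..n}" by auto
  moreover have "(\<Sum>k<n + 1. h $$ (k, k)) = 0" using su unfolding su_iff by blast
  ultimately show "(\<Sum>k\<in>{1..n}. h $$ (k, k)) = 0" using z by simp
qed

lemma index_ad:
  assumes "h \<in> carrier_mat (n + 1) (n + 1)" "X \<in> carrier_mat (n + 1) (n + 1)"
    and "k \<le> n" "l \<le> n"
  shows "ad h X $$ (k, l) =
    h $$ (k, 0) * X $$ (0, l) + (\<Sum>m\<in>{1..n}. h $$ (k, m) * X $$ (m, l))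
    - (X $$ (k, 0) * h $$ (0, l) + (\<Sum>m\<in>{1..n}. X $$ (k, m) * h $$ (m, l)))"
proof -
  have "{0..<Suc n} = insert 0 {1..n}" by auto
  then show ?thesis using assms by (simp add: ad_def scalar_prod_def)
qed

lemma ad_carrier:
  assumes "h \<in> carrier_mat k k" "X \<in> carrier_mat k k"
  shows "ad h X \<in> carrier_mat k k"
  unfolding ad_def by (meson assms minus_carrier_mat mult_carrier_mat)

text \<open>
  Elements of \<open>m1 n\<close> are scalar on the lower right block, the only one on which \<open>h\<close> is nonzero.
\<close>

lemma ad_isotropy_m1:
  assumes h: "h \<in> isotropy_algebra n" and X: "X \<in> m1 n"
  shows "ad h X = 0\<^sub>m (n + 1) (n + 1)"
proof (rule eq_matI)
  note h' = isotropy_algebraD[OF h]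
  obtain r where r: "X = complex_of_real r \<cdot>\<^sub>m T_mat n" using X by (auto simp: m1_eq)
  have c: "X \<in> carrier_mat (n + 1) (n + 1)" by (simp add: r T_mat_eq)
  have e: "X $$ (k, l) = (if k \<noteq> l then 0 else if k = 0 then - (r * (of_nat n * \<i>)) else r * \<i>)"
    if "k \<le> n" "l \<le> n" for k l
    using that by (simp add: r T_mat_eq)
  fix k l assume "k < dim_row (0\<^sub>m (n + 1) (n + 1) :: complex mat)"
    "l < dim_col (0\<^sub>m (n + 1) (n + 1) :: complex mat)"
  then have kl: "k \<le> n" "l \<le> n" by auto
  have "(\<Sum>m\<in>{1..n}. h $$ (k, m) * X $$ (m, l)) =
      (\<Sum>m\<in>{1..n}. if m = l then h $$ (k, l) * (r * \<i>) else 0)"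
    by (rule sum.cong) (use kl e in auto)
  moreover have "(\<Sum>m\<in>{1..n}. X $$ (k, m) * h $$ (m, l)) =
      (\<Sum>m\<in>{1..n}. if m = k then (r * \<i>) * h $$ (k, l) else 0)"
    by (rule sum.cong) (use kl e in auto)
  ultimately have "ad h X $$ (k, l) = 0"
    using kl h'(2,3) by (simp add: index_ad[OF h'(1) c kl] e sum.delta)
      (metis Suc_leI bot_nat_0.not_eq_extremum mult.commute)
  then show "ad h X $$ (k, l) = 0\<^sub>m (n + 1) (n + 1) $$ (k, l)" using kl by simp
qed (use isotropy_algebraD(1)[OF h] X in \<open>auto simp: ad_def m1_eq T_mat_eq\<close>)

text \<open>
  An element of \<open>m2 n\<close> is determined by its first column, on which \<open>h\<close> acts as on \<open>\<complex>\<^sup>n\<close>.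
\<close>

lemma ad_isotropy_m2:
  assumes h: "h \<in> isotropy_algebra n" and X: "X \<in> m2 n"
  shows "ad h X \<in> m2 n"
    and "\<And>k. k \<in> {1..n} \<Longrightarrow> ad h X $$ (k, 0) = (\<Sum>m\<in>{1..n}. h $$ (k, m) * X $$ (m, 0))"
proof -
  note h' = isotropy_algebraD[OF h]
  have c: "X \<in> carrier_mat (n + 1) (n + 1)" and X0: "X $$ (0, 0) = 0"
    and Xskew: "\<And>k. k \<in> {1..n} \<Longrightarrow> X $$ (0, k) = - cnj (X $$ (k, 0))"
    and Xz: "\<And>k l. k \<in> {1..n} \<Longrightarrow> l \<in> {1..n} \<Longrightarrow> X $$ (k, l) = 0"
    using X by (auto simp: m2_eq)
  note i = index_ad[OF h'(1) c]
  show col: "ad h X $$ (k, 0) = (\<Sum>m\<in>{1..n}. h $$ (k, m) * X $$ (m, 0))" if "k \<in> {1..n}" for k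
    using that h'(2,3) by (simp add: i)
  have row: "ad h X $$ (0, k) = - (\<Sum>m\<in>{1..n}. X $$ (0, m) * h $$ (m, k))" if "k \<in> {1..n}" for k
    using that h'(2,3) X0 by (simp add: i)
  show "ad h X \<in> m2 n"
    unfolding m2_eq
  proof (intro CollectI conjI ballI)
    show "ad h X \<in> carrier_mat (n + 1) (n + 1)" using ad_carrier h'(1) c .
    show "ad h X $$ (0, 0) = 0" using h'(2,3) by (simp add: i)
    show "ad h X $$ (k, l) = 0" if "k \<in> {1..n}" "l \<in> {1..n}" for k l
      using that h'(2,3) Xz by (simp add: i)
    show "ad h X $$ (0, k) = - cnj (ad h X $$ (k, 0))" if k: "k \<in> {1..n}" for k
    proof -
      have "X $$ (0, m) * h $$ (m, k) = cnj (h $$ (k, m) * X $$ (m, 0))" if "m \<in> {1..n}" for m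
        using that k Xskew[OF that] h'(4)[of m k] by simp
      then show ?thesis using k by (simp add: col row)
    qed
  qed
qed

lemma m2_part_m2:
  assumes "X \<in> m2 n" "n \<ge> 1"
  shows "m1_part n X = 0\<^sub>m (n + 1) (n + 1)" "m2_part n X = X"
proof -
  have "X \<in> carrier_mat (n + 1) (n + 1)" using assms by (auto simp: m2_eq)
  then have "0\<^sub>m (n + 1) (n + 1) + X = X" by (rule left_add_zero_mat)
  then show "m1_part n X = 0\<^sub>m (n + 1) (n + 1)" "m2_part n X = X"
    using m1_part_add[OF zero_in_m(1) assms] by auto
qed

lemma metric_m2:
  assumes "X \<in> m2 n" "Y \<in> m2 n" "n \<ge> 1"
  shows "metric n a b X Y = 2 * b * (\<Sum>k\<in>{1..n}. Re (X $$ (k, 0) * cnj (Y $$ (k, 0))))"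
  using assms
  by (simp add: metric_def m2_part_m2 B0_eq[of "0\<^sub>m (Suc n) (Suc n)" "Suc n"] B0_m2)

lemma basis_vec_column:
  assumes "q \<noteq> 1" "k \<in> {1..n}"
  shows "basis_vec n a b q $$ (k, 0) = (if k = q div 2 then
    (if even q then 1 else \<i>) * complex_of_real (1 / sqrt (2 * b)) else 0)"
  using assms by (auto simp: basis_vec_def E_mat_def F_mat_def)

text \<open>
  In the column picture, an even index stands for a real and an odd index for an imaginary multiple
  of a standard basis vector, and the metric is a multiple of the real part of the Hermitian
  product; that multiple is absorbed by the normalisation of the basis.
\<close>

lemma metric_ad_basis:
  assumes h: "h \<in> isotropy_algebra n" and n: "n \<ge> 1" and b: "b > 0"
    and i: "i \<in> {1..2 * n + 1}" "i \<noteq> 1" and j: "j \<in> {1..2 * n + 1}" "j \<noteq> 1"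
  shows "metric n a b (ad h (basis_vec n a b i)) (basis_vec n a b j) =
    Re (h $$ (j div 2, i div 2) * (if even i then 1 else \<i>) * cnj (if even j then 1 else \<i>))"
proof -
  let ?e = "basis_vec n a b"
  define s where "s = complex_of_real (1 / sqrt (2 * b))"
  define u where "u k = (if even k then 1 else \<i>)" for k :: nat
  have s: "s * cnj s = of_real (1 / (2 * b))"
    using b by (simp add: s_def flip: of_real_mult)
  have i2: "i div 2 \<in> {1..n}" and j2: "j div 2 \<in> {1..n}" using i j by auto
  have ei: "?e i \<in> m2 n" and ej: "?e j \<in> m2 n" using basis_vec_in_m(2) i j by auto
  have col: "ad h (?e i) $$ (k, 0) = h $$ (k, i div 2) * u i * s" if k: "k \<in> {1..n}" for k
  proof -
    have "ad h (?e i) $$ (k, 0) = (\<Sum>m\<in>{1..n}. if m = i div 2 then h $$ (k, i div 2) * u i * s else 0)"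
      unfolding ad_isotropy_m2(2)[OF h ei k]
      by (rule sum.cong) (use i in \<open>auto simp: basis_vec_column u_def s_def\<close>)
    then show ?thesis using i2 by (simp add: sum.delta)
  qed
  have "(\<Sum>k\<in>{1..n}. Re (ad h (?e i) $$ (k, 0) * cnj (?e j $$ (k, 0)))) =
     (\<Sum>k\<in>{1..n}. if k = j div 2 then Re (h $$ (k, i div 2) * u i * cnj (u j) * (s * cnj s)) else 0)"
    by (rule sum.cong) (use j in \<open>auto simp: col basis_vec_column u_def s_def ac_simps\<close>)
  also have "\<dots> = Re (h $$ (j div 2, i div 2) * u i * cnj (u j) * (s * cnj s))"
    using j2 by (simp add: sum.delta)
  also have "\<dots> = Re (h $$ (j div 2, i div 2) * u i * cnj (u j)) / (2 * b)"
    unfolding s by simp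
  finally show ?thesis
    unfolding metric_m2[OF ad_isotropy_m2(1)[OF h ei] ej n] using b by (simp add: u_def)
qed


section \<open>The spin lift of the isotropy representation\<close>

lemma sum_spinor_apply: "(\<Sum>x\<in>A. f x) K = (\<Sum>x\<in>A. (f x :: spinor) K)"
  by (induction A rule: infinite_finite_induct) auto

text \<open>
  The spin lift is, up to sign, the derivation extending \<open>y\<^sub>q \<mapsto> \<Sum> h\<^sub>q\<^sub>p y\<^sub>p\<close>. Lines paired with themselves
  contribute the diagonal terms and half the trace of \<open>h\<close>, which is zero; a pair of different
  lines contributes the two off-diagonal terms, once \<open>c\<^sub>p w\<^sub>q\<close> is replaced by \<open>- w\<^sub>q c\<^sub>p\<close> and
  skew-Hermitian symmetry is used to remove the conjugate.
\<close>

lemma spin_lift_isotropy: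
  assumes h: "h \<in> isotropy_algebra n" and n: "n \<ge> 1" and b: "b > 0"
    and \<eta>: "\<eta> \<in> spin_module n"
  shows "spin_lift n a b (ad h) \<eta> K =
    - (\<Sum>p\<in>{1..n}. \<Sum>q\<in>{1..n}. h $$ (q, p) * (y_gen p \<and>\<^sub>\<Sigma> contract q \<eta>) K)"
proof -
  note h' = isotropy_algebraD[OF h]
  define g where "g i j = metric n a b (ad h (basis_vec n a b i)) (basis_vec n a b j)" for i j
  define f where "f i j = of_real (g i j) * (1 / 2) * clifford i (clifford j \<eta>) K" for i j
  define D where "D p q = h $$ (q, p) * (y_gen p \<and>\<^sub>\<Sigma> contract q \<eta>) K" for p q
  have f1: "f 1 j = 0" if "j \<in> {2..2 * n + 1}" for j
  proof -
    have "basis_vec n a b j \<in> m2 n" using basis_vec_in_m(2)[of j] that by auto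
    then have "metric n a b (0\<^sub>m (n + 1) (n + 1)) (basis_vec n a b j) = 0"
      unfolding metric_m2[OF zero_in_m(2) \<open>basis_vec n a b j \<in> m2 n\<close> n] by simp
    then show ?thesis
      using ad_isotropy_m1[OF h basis_vec_in_m(1)[of 1 n a b]] by (simp add: f_def g_def)
  qed
  have g: "g (2 * p) (2 * q) = Re (h $$ (q, p))" "g (2 * p) (2 * q + 1) = Im (h $$ (q, p))"
     "g (2 * p + 1) (2 * q) = - Im (h $$ (q, p))" "g (2 * p + 1) (2 * q + 1) = Re (h $$ (q, p))"
    if "p \<in> {1..n}" "q \<in> {1..n}" for p q
    unfolding g_def using that by (auto simp: metric_ad_basis[OF h n b])
  \<comment> \<open>Diagonal entries are imaginary, so that the coefficient in \<open>Im\<close> captures the whole entry.\<close>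
  have line: "f (2 * q) (2 * q + 1) = h $$ (q, q) / 2 * \<eta> K - D q q" if q: "q \<in> {1..n}" for q
  proof -
    have "Re (h $$ (q, q)) = 0" using arg_cong[OF h'(4)[of q q], of Re] q by simp
    then have hq: "h $$ (q, q) = \<i> * of_real (Im (h $$ (q, q)))" by (simp add: complex_eq_iff)
    have "f (2 * q) (2 * q + 1) = (\<i> * of_real (Im (h $$ (q, q)))) / 2 * \<eta> K
      - (\<i> * of_real (Im (h $$ (q, q)))) * (y_gen q \<and>\<^sub>\<Sigma> contract q \<eta>) K"
      unfolding f_def g(2)[OF q q]
      using q by (simp only: clifford_complex_line[OF _ \<eta>] atLeastAtMost_iff)
        (simp add: spinor_scale_def algebra_simps)
    then show ?thesis unfolding D_def hq[symmetric] .
  qed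
  have pair: "f (2 * p) (2 * q) + f (2 * p) (2 * q + 1) + f (2 * p + 1) (2 * q)
      + f (2 * p + 1) (2 * q + 1) = - (D p q + D q p)"
    if q: "q \<in> {1..n}" and p: "p \<in> {1..<q}" for p q
  proof -
    have p': "p \<in> {1..n}" and pq: "p \<noteq> q" using p q by auto
    have "f (2 * p) (2 * q) + f (2 * p) (2 * q + 1) + f (2 * p + 1) (2 * q)
      + f (2 * p + 1) (2 * q + 1) =
      - cnj (h $$ (q, p)) * contract p (y_gen q \<and>\<^sub>\<Sigma> \<eta>) K - h $$ (q, p) * (y_gen p \<and>\<^sub>\<Sigma> contract q \<eta>) K"
      unfolding f_def g[OF p' q]
      by (rule complex_linear_pair_clifford) (use p' q in auto)
    also have "- cnj (h $$ (q, p)) = h $$ (p, q)" using h'(4)[of p q] p' q by simp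
    also have "contract p (y_gen q \<and>\<^sub>\<Sigma> \<eta>) K = - (y_gen q \<and>\<^sub>\<Sigma> contract p \<eta>) K"
      using pq by (simp add: contract_y_wedge[OF \<eta>])
    finally show ?thesis by (simp add: D_def)
  qed
  have "spin_lift n a b (ad h) \<eta> K = (\<Sum>j\<in>{1..2 * n + 1}. \<Sum>i\<in>{1..<j}. f i j)"
    unfolding spin_lift_def sum_spinor_apply f_def g_def spinor_scale_def ..
  also have "\<dots> = (\<Sum>q\<in>{1..n}. f (2 * q) (2 * q + 1) + (\<Sum>p\<in>{1..<q}.
        f (2 * p) (2 * q) + f (2 * p) (2 * q + 1)
        + f (2 * p + 1) (2 * q) + f (2 * p + 1) (2 * q + 1)))"
    by (rule sum_increasing_pairs_split_parity) (rule f1)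
  also have "\<dots> = (\<Sum>q\<in>{1..n}. (h $$ (q, q) / 2 * \<eta> K - D q q) + (\<Sum>p\<in>{1..<q}. - (D p q + D q p)))"
    by (intro sum.cong arg_cong2[of _ _ _ _ "(+)"] refl line pair)
  also have "\<dots> = (\<Sum>q\<in>{1..n}. h $$ (q, q)) / 2 * \<eta> K
      - (\<Sum>q\<in>{1..n}. D q q + (\<Sum>p\<in>{1..<q}. D p q + D q p))"
    by (simp add: sum.distrib sum_subtractf sum_negf sum_divide_distrib sum_distrib_right)
  also have "\<dots> = - (\<Sum>p\<in>{1..n}. \<Sum>q\<in>{1..n}. D p q)"
    unfolding sum_square_by_triangles[symmetric] h'(5) by simp
  finally show ?thesis by (simp only: D_def)
qed


section \<open>Invariant spinors\<close>

text \<open>The operator \<open>w\<^sub>p c\<^sub>p\<close> counts the generator \<open>y\<^sub>p\<close>: the two signs agree and cancel.\<close>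

lemma y_wedge_contract_same:
  assumes "finite K"
  shows "(y_gen p \<and>\<^sub>\<Sigma> contract p \<eta>) K = (if p \<in> K then \<eta> K else 0)"
proof -
  have "{i \<in> K. i \<noteq> p \<and> i < p} = {i \<in> K. i < p}" by auto
  then show ?thesis using assms
    by (auto simp: y_wedge contract_def insert_absorb simp flip: power_add mult.assoc)
qed

text \<open>
  Weights under the diagonal elements exclude all other monomials; the vanishing trace is what
  makes the full product invariant under the whole algebra.
\<close>

lemma invariant_spinors_iff:
  assumes n: "n \<ge> 1" and b: "b > 0"
  shows "\<psi> \<in> invariant_spinors n a b \<longleftrightarrow> (\<forall>K. \<psi> K \<noteq> 0 \<longrightarrow> K = {} \<or> K = {1..n})"
proof
  assume inv: "\<psi> \<in> invariant_spinors n a b"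
  then have mem: "\<psi> \<in> spin_module n" by (simp add: invariant_spinors_def)
  have same: "p \<in> K \<longleftrightarrow> q \<in> K"
    if K: "\<psi> K \<noteq> 0" and pq: "p \<in> {1..n}" "q \<in> {1..n}" "p \<noteq> q" for K p q
  proof -
    have fin: "finite K" using mem K finite_subset unfolding spin_module_def by blast
    \<comment> \<open>The diagonal element whose weight on a monomial compares the occurrences of \<open>p\<close> and \<open>q\<close>.\<close>
    define t where "t k = (if k = p then \<i> else if k = q then - \<i> else 0)" for k
    define h where "h = mat (n + 1) (n + 1) (\<lambda>(k, l). if k = l then t k else 0)"
    have t_sum: "(\<Sum>k\<in>A. t k * u k) = (if p \<in> A then \<i> * u p else 0) - (if q \<in> A then \<i> * u q else 0)"
      if "finite A" for A and u :: "nat \<Rightarrow> complex"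
    proof -
      have "(\<Sum>k\<in>A. t k * u k) = (\<Sum>k\<in>A. (if k = p then \<i> * u p else 0) - (if k = q then \<i> * u q else 0))"
        by (rule sum.cong) (use pq in \<open>auto simp: t_def\<close>)
      then show ?thesis using that by (simp add: sum_subtractf sum.delta)
    qed
    have "h \<in> isotropy_algebra n"
      unfolding isotropy_algebra_iff su_iff
    proof (intro conjI allI impI)
      have "(\<Sum>k<n + 1. h $$ (k, k)) = (\<Sum>k<n + 1. t k * 1)"
        by (rule sum.cong) (auto simp: h_def)
      then show "(\<Sum>k<n + 1. h $$ (k, k)) = 0"
        using pq by (simp only: t_sum finite_lessThan) simp
    qed (use pq in \<open>auto simp: h_def t_def\<close>)
    then have "spin_lift n a b (ad h) \<psi> K = 0"
      using inv by (simp add: invariant_spinors_def)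
    moreover have "spin_lift n a b (ad h) \<psi> K =
        - (\<Sum>p'\<in>{1..n}. t p' * (if p' \<in> K then \<psi> K else 0))"
      unfolding spin_lift_isotropy[OF \<open>h \<in> isotropy_algebra n\<close> n b mem]
    proof (intro arg_cong[of _ _ uminus] sum.cong refl)
      fix k assume k: "k \<in> {1..n}"
      have "(\<Sum>l\<in>{1..n}. h $$ (l, k) * (y_gen k \<and>\<^sub>\<Sigma> contract l \<psi>) K) =
          (\<Sum>l\<in>{1..n}. if l = k then t k * (y_gen k \<and>\<^sub>\<Sigma> contract k \<psi>) K else 0)"
        by (rule sum.cong) (use k in \<open>auto simp: h_def\<close>)
      then show "(\<Sum>l\<in>{1..n}. h $$ (l, k) * (y_gen k \<and>\<^sub>\<Sigma> contract l \<psi>) K) =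
          t k * (if k \<in> K then \<psi> K else 0)"
        using k by (simp add: y_wedge_contract_same[OF fin])
    qed
    ultimately show ?thesis
      using pq K t_sum[of "{1..n}" "\<lambda>k. if k \<in> K then \<psi> K else 0"] by (auto split: if_splits)
  qed
  show "\<forall>K. \<psi> K \<noteq> 0 \<longrightarrow> K = {} \<or> K = {1..n}"
  proof (intro allI impI)
    fix K assume K: "\<psi> K \<noteq> 0"
    then have "K \<subseteq> {1..n}" using mem unfolding spin_module_def by blast
    then show "K = {} \<or> K = {1..n}" using same[OF K] by blast
  qed
next
  assume supp: "\<forall>K. \<psi> K \<noteq> 0 \<longrightarrow> K = {} \<or> K = {1..n}"
  then have mem: "\<psi> \<in> spin_module n" unfolding spin_module_def by blast
  have "spin_lift n a b (ad h) \<psi> K = 0" if h: "h \<in> isotropy_algebra n" for h K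
  proof -
    have "(\<Sum>q\<in>{1..n}. h $$ (q, p) * (y_gen p \<and>\<^sub>\<Sigma> contract q \<psi>) K) =
        h $$ (p, p) * (if K = {1..n} then \<psi> K else 0)" if p: "p \<in> {1..n}" for p
    proof -
      have off: "(y_gen p \<and>\<^sub>\<Sigma> contract q \<psi>) K = 0" if "q \<noteq> p" for q
      proof -
        \<comment> \<open>The index set reached contains \<open>q\<close> but not \<open>p\<close>, so it is neither empty nor full.\<close>
        have "p \<notin> insert q (K - {p})" using that by simp
        then have "\<psi> (insert q (K - {p})) = 0" using supp p by blast
        then show ?thesis by (simp add: y_wedge contract_def)
      qed
      have "(y_gen p \<and>\<^sub>\<Sigma> contract p \<psi>) K = (if K = {1..n} then \<psi> K else 0)"
      proof (cases "finite K")
        case True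
        then show ?thesis using supp p by (auto simp: y_wedge_contract_same)
      next
        case False
        then show ?thesis by (auto simp: y_wedge)
      qed
      then have "(\<Sum>q\<in>{1..n}. h $$ (q, p) * (y_gen p \<and>\<^sub>\<Sigma> contract q \<psi>) K) =
        (\<Sum>q\<in>{1..n}. if q = p then h $$ (p, p) * (if K = {1..n} then \<psi> K else 0) else 0)"
        using off by (intro sum.cong) auto
      then show ?thesis using p by (simp add: sum.delta)
    qed
    then have "spin_lift n a b (ad h) \<psi> K =
        - ((\<Sum>p\<in>{1..n}. h $$ (p, p)) * (if K = {1..n} then \<psi> K else 0))"
      unfolding spin_lift_isotropy[OF h n b mem] sum_distrib_right by simp
    then show ?thesis by (simp only: isotropy_algebraD(5)[OF h]) simp
  qed
  then show "\<psi> \<in> invariant_spinors n a b"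
    using mem by (auto simp: invariant_spinors_def fun_eq_iff)
qed

text \<open>
  The product is built up from the right, so that each new generator has a smaller index than those
  already present; no transposition, and hence no sign, arises.
\<close>

lemma psi_minus_eq: "psi_minus n = (\<lambda>I. if I = {1..n} then 1 else 0)"
proof -
  have "foldr (\<lambda>j \<eta>. y_gen j \<and>\<^sub>\<Sigma> \<eta>) [m..<n + 1] ext_one = (\<lambda>I. if I = {m..n} then 1 else 0)"
    if "m \<le> n + 1" for m
    using that
  proof (induction m rule: inc_induct)
    case base
    then show ?case by (simp add: ext_one_def)
  next
    case (step m)
    let ?top = "\<lambda>m I. if I = {m..n} then 1 else 0 :: complex"
    have wedge_top: "(y_gen m \<and>\<^sub>\<Sigma> ?top (Suc m)) I = ?top m I" for I
    proof (cases "I = {m..n}")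
      case True
      have no_transposition: "{i \<in> {m..n}. i < m} = {}" and rest: "{m..n} - {m} = {Suc m..n}"
        by auto
      then show ?thesis
        using step.hyps unfolding True y_wedge no_transposition rest by simp
    next
      case False
      have "insert m {Suc m..n} = {m..n}" using step.hyps by auto
      then have "I - {m} \<noteq> {Suc m..n}" if "m \<in> I"
        using False insert_Diff[OF that] by metis
      then show ?thesis using False by (simp add: y_wedge)
    qed
    have "[m..<n + 1] = m # [Suc m..<n + 1]" using step.hyps by (intro upt_conv_Cons) simp
    then have "foldr (\<lambda>j \<eta>. y_gen j \<and>\<^sub>\<Sigma> \<eta>) [m..<n + 1] ext_one = y_gen m \<and>\<^sub>\<Sigma> ?top (Suc m)"
      by (simp only: foldr_Cons o_apply step.IH)
    also have "\<dots> = ?top m" by (rule ext) (rule wedge_top)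
    finally show ?case .
  qed
  from this[of 1] show ?thesis by (simp add: psi_minus_def)
qed

theorem theorem3p7:
  fixes n :: nat and a b :: real
  assumes "n \<ge> 1" and "a > 0" and "b > 0"
  shows "invariant_spinors n a b = spinor.span {psi_plus, psi_minus n}"
proof -
  have ne: "{} \<noteq> {1..n}" using assms(1) by auto
  have span: "\<psi> \<in> spinor.span {psi_plus, psi_minus n} \<longleftrightarrow>
      (\<exists>c d. \<psi> = spinor_scale c psi_plus + spinor_scale d (psi_minus n))" for \<psi>
    unfolding spinor.span_insert spinor.span_empty mem_Collect_eq singleton_iff
    by (simp only: right_minus_eq diff_eq_eq add_0_left add.commute[of "spinor_scale _ psi_plus"])
  have "(\<forall>K. \<psi> K \<noteq> 0 \<longrightarrow> K = {} \<or> K = {1..n}) \<longleftrightarrow>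
      (\<exists>c d. \<psi> = spinor_scale c psi_plus + spinor_scale d (psi_minus n))" (is "?L \<longleftrightarrow> ?R") for \<psi>
  proof
    assume L: ?L
    have eq: "\<psi> K = \<psi> {} * psi_plus K + \<psi> {1..n} * psi_minus n K" for K
    proof (cases "\<psi> K = 0")
      case True
      then show ?thesis unfolding psi_plus_def ext_one_def psi_minus_eq by fastforce
    next
      case False
      then consider "K = {}" | "K = {1..n}" using L by blast
      then show ?thesis
        using ne by cases (auto simp: psi_plus_def ext_one_def psi_minus_eq)
    qed
    have "\<psi> = spinor_scale (\<psi> {}) psi_plus + spinor_scale (\<psi> {1..n}) (psi_minus n)"
      by (rule ext) (unfold plus_fun_apply spinor_scale_def, rule eq)
    then show ?R by blast
  next
    assume ?R
    then obtain c d where "\<psi> = spinor_scale c psi_plus + spinor_scale d (psi_minus n)" by blast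
    then show ?L
      by (simp add: spinor_scale_def psi_plus_def ext_one_def psi_minus_eq)
  qed
  then show ?thesis
    unfolding set_eq_iff invariant_spinors_iff[OF assms(1,3)] span by blast
qed

end
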